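(* Let $G$ be an infinite countable amenable group and let $A$ be a finite-dimensional vector space over a field. Then for every linear non-uniform cellular automaton $\tau\colon A^G\to A^G$ with finite memory, the following hold. (i) If $\tau|_U$ is pre-injective, where $U=\{0\}^S\times A^{G\setminus S}=\{x\in A^G: x|_S=0\}$ for some $S\subset G$, then $\overline{\mathrm{mdim}}_{\mathcal F}(\operatorname{Im}\tau)\geq(1-\overline d_{\mathcal F}(S))\dim A$ for every Følner sequence $\mathcal F$ of $G$. (ii) If $\dim A=1$ and $d$ is a real number with $\underline{\mathrm{mDim}}(\operatorname{Im}\tau)>1-d$, then there exists $S\subset G$ with $\overline D_G(S)\leq d$ such that $\tau|_U$ is pre-injective, where $U=\{0\}^S\times A^{G\setminus S}$.
   Context: $A^G$ is the vector space of all maps $x\colon G\to A$, with shift action $(gx)(h)=x(g^{-1}h)$ of $G$. A Følner net of $G$ is a family $\mathcal F=(F_i)_{i\in I}$ of nonempty finite subsets of $G$ indexed by a directed set $I$ with $\lim_i|F_i\setminus F_ig|/|F_i|=0$ for all $g\in G$ (a Følner sequence if $I=\mathbb N$); $G$ is amenable if it has a Følner net. A linear non-uniform cellular automaton (NUCA) with finite memory is a map $\tau\colon A^G\to A^G$ for which there are a finite set $M\subset G$ and linear maps $s(g)\colon A^M\to A$, $g\in G$, with $\tau(x)(g)=s(g)\big((g^{-1}x)|_M\big)$ for all $x\in A^G$, $g\in G$. Its image is $\operatorname{Im}\tau=\tau(A^G)$. $x,y\in A^G$ are asymptotic if they coincide outside a finite subset of $G$. $\tau|_U$ is pre-injective if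 for all asymptotic $x,y\in U$, $\tau(x)=\tau(y)$ implies $x=y$. Densities: for $S\subset G$ and a Følner net $\mathcal F=(F_i)_{i\in I}$, the upper natural $\mathcal F$-density is $\overline d_{\mathcal F}(S)=\limsup_i\frac{|S\cap F_i|}{|F_i|}$, and the upper Banach density is $\overline D_G(S)=\liminf_i\sup_{g\in G}\frac{|S\cap F_ig|}{|F_i|}$. The upper Banach density is taken to be independent of the Følner net, the liminf being a limit equal to $\inf_{F}\sup_{g\in G}\frac{|S\cap Fg|}{|F|}$ over nonempty finite $F\subset G$. Mean dimensions: for a vector subspace $X\subset A^G$ and $F\subset G$, put $X_F=\{x|_F:x\in X\}\subset A^F$ and $gX=\{gx:x\in X\}$. For a Følner net $\mathcal F=(F_i)_{i\in I}$, the upper natural mean $\mathcal F$-dimension is $\overline{\mathrm{mdim}}_{\mathcal F}(X)=\limsup_i\frac{\dim X_{F_i}}{|F_i|}$, and the lower Banach mean dimension is $\underline{\mathrm{mDim}}(X)=\lim_i\inf_{g\in G}\frac{\dim (gX)_{F_i}}{|F_i|}$.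
   Formalization: The upper Banach density is taken with left translates gF_i in place of F_i g; with F_i g part (ii) is false in groups having an infinite conjugacy class, and in commutative groups the two agree. *)

theory Defs
  imports Complex_Main
    "HOL-Library.Function_Algebras"
    "HOL-Library.Countable_Set"
    "HOL-Library.Extended_Real"
    "HOL-Library.Liminf_Limsup"
begin

(* The group is a type of class group_add, which does not include commutativity: "g + h", "- g"
   and "0" are the product, the inverse and the neutral element. *)

section \<open>Configurations\<close>

definition shift :: "'g::group_add \<Rightarrow> ('g \<Rightarrow> 'a) \<Rightarrow> 'g \<Rightarrow> 'a" where
  "shift g x = (\<lambda>h. x (- g + h))"

definition fun_scale :: "('k \<Rightarrow> 'a \<Rightarrow> 'a) \<Rightarrow> 'k \<Rightarrow> ('g \<Rightarrow> 'a) \<Rightarrow> 'g \<Rightarrow> 'a" where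
  "fun_scale scale c x = (\<lambda>h. scale c (x h))"

(* A^F is identified with the configurations vanishing outside F. Extension by 0, unlike
   extension by undefined, keeps it a linear subspace of the space of all configurations. *)
definition restr :: "'g set \<Rightarrow> ('g \<Rightarrow> 'a::zero) \<Rightarrow> 'g \<Rightarrow> 'a" where
  "restr F x = (\<lambda>h. if h \<in> F then x h else 0)"

definition vanishing_on :: "'g set \<Rightarrow> ('g \<Rightarrow> 'a::zero) set" where
  "vanishing_on S = {x. \<forall>h\<in>S. x h = 0}"

definition asymptotic :: "('g \<Rightarrow> 'a) \<Rightarrow> ('g \<Rightarrow> 'a) \<Rightarrow> bool" where
  "asymptotic x y \<longleftrightarrow> finite {h. x h \<noteq> y h}"

definition pre_injective_on :: "(('g \<Rightarrow> 'a) \<Rightarrow> 'b) \<Rightarrow> ('g \<Rightarrow> 'a) set \<Rightarrow> bool" where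
  "pre_injective_on \<tau> U \<longleftrightarrow>
    (\<forall>x\<in>U. \<forall>y\<in>U. asymptotic x y \<and> \<tau> x = \<tau> y \<longrightarrow> x = y)"

(* Each local map is only ever applied to elements of A^M. Requiring it to be linear on all
   configurations is no restriction: a linear map on A^M extends by composition with restr M. *)
definition linear_nuca ::
  "('k::field \<Rightarrow> 'a::ab_group_add \<Rightarrow> 'a) \<Rightarrow> (('g::group_add \<Rightarrow> 'a) \<Rightarrow> 'g \<Rightarrow> 'a) \<Rightarrow> bool" where
  "linear_nuca scale \<tau> \<longleftrightarrow>
    (\<exists>(M :: 'g set) (s :: 'g \<Rightarrow> ('g \<Rightarrow> 'a) \<Rightarrow> 'a).
      finite M \<and>
      (\<forall>g. Vector_Spaces.linear (fun_scale scale) scale (s g)) \<and>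
      (\<forall>x g. \<tau> x g = s g (restr M (shift (- g) x))))"

section \<open>Folner nets\<close>

definition directed_set :: "'i set \<Rightarrow> ('i \<Rightarrow> 'i \<Rightarrow> bool) \<Rightarrow> bool" where
  "directed_set I le \<longleftrightarrow>
    I \<noteq> {} \<and>
    (\<forall>i\<in>I. le i i) \<and>
    (\<forall>i\<in>I. \<forall>j\<in>I. \<forall>k\<in>I. le i j \<longrightarrow> le j k \<longrightarrow> le i k) \<and>
    (\<forall>i\<in>I. \<forall>j\<in>I. \<exists>k\<in>I. le i k \<and> le j k)"

(* Limits along this filter are the limits of nets indexed by I; for I = UNIV :: nat set with its
   usual order it is the filter sequentially. *)
definition net_filter :: "'i set \<Rightarrow> ('i \<Rightarrow> 'i \<Rightarrow> bool) \<Rightarrow> 'i filter" where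
  "net_filter I le = (INF i\<in>I. principal {j\<in>I. le i j})"

definition folner_net ::
  "'i set \<Rightarrow> ('i \<Rightarrow> 'i \<Rightarrow> bool) \<Rightarrow> ('i \<Rightarrow> 'g::group_add set) \<Rightarrow> bool" where
  "folner_net I le F \<longleftrightarrow>
    directed_set I le \<and>
    (\<forall>i\<in>I. finite (F i) \<and> F i \<noteq> {}) \<and>
    (\<forall>g. ((\<lambda>i. real (card (F i - (\<lambda>f. f + g) ` F i)) / real (card (F i))) \<longlongrightarrow> 0)
           (net_filter I le))"

definition folner_seq :: "(nat \<Rightarrow> 'g::group_add set) \<Rightarrow> bool" where
  "folner_seq F \<longleftrightarrow> folner_net UNIV (\<le>) F"

section \<open>Densities\<close>

definition upper_density :: "(nat \<Rightarrow> 'g set) \<Rightarrow> 'g set \<Rightarrow> ereal" where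
  "upper_density F S =
    limsup (\<lambda>i. ereal (real (card (S \<inter> F i)) / real (card (F i))))"

(* The translates are the left translates g F_i. With the Folner condition above, which is
   invariance under right multiplication, this is the side for which the liminf is a limit, does
   not depend on the Folner net, and equals the infimum over all nonempty finite sets F of
   sup_g |S \<inter> g F| / |F|: if |S \<inter> g F| \<le> c |F| for all g, then for every finite E, summing
   |S \<inter> g e F| over e in E gives that the sum of |S \<inter> g E f| over f in F is at most c |E| |F|,
   and E f is close to E when E is far along a Folner net. It is also the side of the lower Banach
   mean dimension below, since (g X)_F is X on the left translate of F by the inverse of g.

   With right translates F_i g these properties fail in noncommutative groups, and the density is
   not comparable to the mean dimension. Let h have an infinite conjugacy class and let F_0, F_1, ...
   be an enumeration of the finite subsets of the group. Since h has infinitely many conjugates,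
   there are g_n, chosen successively, such that the union R of the F_n g_n contains no two
   elements r and r h. So |R \<inter> g {1, h}| \<le> 1 for all g, while R contains a right translate of every
   finite set. For the cellular automaton x \<mapsto> 1_(G - R) x, the lower Banach mean dimension of the
   image is at least dim A / 2, yet any S for which the restriction is pre-injective contains R (if
   A is nonzero), so all right-translate densities of S are 1.

   In commutative groups the two sides agree. *)
definition upper_Banach_density ::
  "'i set \<Rightarrow> ('i \<Rightarrow> 'i \<Rightarrow> bool) \<Rightarrow> ('i \<Rightarrow> 'g::group_add set) \<Rightarrow> 'g set \<Rightarrow> ereal" where
  "upper_Banach_density I le F S =
    Liminf (net_filter I le)
      (\<lambda>i. SUP g. ereal (real (card (S \<inter> (\<lambda>f. g + f) ` F i)) / real (card (F i))))"

section \<open>Mean dimensions\<close>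

definition dim_on ::
  "('k::field \<Rightarrow> 'a::ab_group_add \<Rightarrow> 'a) \<Rightarrow> 'g set \<Rightarrow> ('g \<Rightarrow> 'a) set \<Rightarrow> nat" where
  "dim_on scale F X = vector_space.dim (fun_scale scale) (restr F ` X)"

definition upper_mdim ::
  "('k::field \<Rightarrow> 'a::ab_group_add \<Rightarrow> 'a) \<Rightarrow> (nat \<Rightarrow> 'g set) \<Rightarrow> ('g \<Rightarrow> 'a) set \<Rightarrow> ereal" where
  "upper_mdim scale F X =
    limsup (\<lambda>i. ereal (real (dim_on scale (F i) X) / real (card (F i))))"

(* For X the image of a linear cellular automaton with finite memory the limit exists, so Lim is
   its actual value. *)
definition lower_Banach_mdim ::
  "('k::field \<Rightarrow> 'a::ab_group_add \<Rightarrow> 'a) \<Rightarrow> 'i set \<Rightarrow> ('i \<Rightarrow> 'i \<Rightarrow> bool) \<Rightarrow>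
    ('i \<Rightarrow> 'g::group_add set) \<Rightarrow> ('g \<Rightarrow> 'a) set \<Rightarrow> ereal" where
  "lower_Banach_mdim scale I le F X =
    Lim (net_filter I le)
      (\<lambda>i. INF g. ereal (real (dim_on scale (F i) (shift g ` X)) / real (card (F i))))"

end

theory Submission
  imports Defs
begin

text \<open>View \<open>\<tau>\<close> as a matrix over \<open>G\<close> with finitely supported rows and columns. Pre-injectivity on the
  configurations vanishing on \<open>S\<close> says that the columns outside \<open>S\<close> are linearly independent, and
  the dimension of the image on \<open>F\<close> is the rank of the rows in \<open>F\<close>; up to the boundary of \<open>F\<close> it is
  at least the number of independent columns in \<open>F - S\<close>. This is the first part. For the second part
  any maximal independent set of columns will do: it makes the rank on \<open>F\<close> agree with
  \<open>card (F - S)\<close> up to the boundary of \<open>F\<close>, uniformly over all translates. So the lower Banach mean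
  dimension equals 1 minus the upper Banach density of \<open>S\<close>, once the latter is known to be a limit;
  that follows by averaging over translates.\<close>

section \<open>Counting in translates\<close>

text \<open>This is the product set \<open>F + K\<close>. The factor \<open>K\<close> stands on the
  right, so the construction commutes with left translations and its excess over \<open>F\<close> is
  controlled by the Folner condition.\<close>

definition spread :: "'g::group_add set \<Rightarrow> 'g set \<Rightarrow> 'g set" where
  "spread K F = (\<Union>k\<in>K. (\<lambda>f. f + k) ` F)"

lemma finite_spread: "finite K \<Longrightarrow> finite F \<Longrightarrow> finite (spread K F)"
  by (simp add: spread_def)

lemma in_spreadI: "f \<in> F \<Longrightarrow> k \<in> K \<Longrightarrow> f + k \<in> spread K F"
  by (auto simp: spread_def)

lemma spread_translate: "spread K ((+) g ` F) = (+) g ` spread K F"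
  by (simp add: spread_def image_UN image_image add.assoc)

lemma card_translate: "card ((+) (g::'g::group_add) ` F) = card F"
  by (intro card_image inj_onI) simp

lemma card_spread_diff_translate:
  "card (spread K ((+) g ` F) - (+) g ` F) = card (spread K F - F)"
proof -
  have "(+) g ` spread K F - (+) g ` F = (+) g ` (spread K F - F)"
    by (rule image_set_diff[symmetric]) (auto intro: injI)
  then show ?thesis
    by (simp add: spread_translate card_translate)
qed

text \<open>A right translate of \<open>F\<close> is as large as \<open>F\<close>, so what it gains
  outside \<open>F\<close> equals what \<open>F\<close> loses, and the Folner condition speaks of
  the loss.\<close>

lemma card_spread_diff_le:
  assumes "finite K" "finite F"
  shows "card (spread K F - F) \<le> (\<Sum>k\<in>K. card (F - (\<lambda>f. f + k) ` F))"
proof -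
  have "spread K F - F = (\<Union>k\<in>K. (\<lambda>f. f + k) ` F - F)"
    by (auto simp: spread_def)
  then have "card (spread K F - F) \<le> (\<Sum>k\<in>K. card ((\<lambda>f. f + k) ` F - F))"
    using card_UN_le[OF assms(1)] by metis
  also have "\<dots> = (\<Sum>k\<in>K. card (F - (\<lambda>f. f + k) ` F))"
  proof (intro sum.cong refl)
    fix k
    have "card ((\<lambda>f. f + k) ` F) = card F"
      by (intro card_image inj_onI) simp
    then show "card ((\<lambda>f. f + k) ` F - F) = card (F - (\<lambda>f. f + k) ` F)"
      using assms(2) by (simp add: card_Diff_subset_Int Int_commute)
  qed
  finally show ?thesis .
qed

text \<open>Double counting of the pairs \<open>(e, f)\<close> with \<open>g + e + f\<close> in
  \<open>S\<close>. For fixed \<open>e\<close> the frequency bound \<open>c\<close> applies to the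
  left translate of \<open>F\<close> by \<open>g + e\<close>. For fixed \<open>f\<close> the pairs
  are at least as many as the points of \<open>S\<close> in the left translate of \<open>E\<close>
  by \<open>g\<close>, up to the part of \<open>E\<close> outside its right translate by
  \<open>f\<close>. Averaging over \<open>f\<close> gives the claim.\<close>

lemma card_Int_translate_le:
  fixes S :: "'g::group_add set"
  assumes "finite E" "finite F" "F \<noteq> {}"
    and c: "\<And>g. real (card (S \<inter> (+) g ` F)) \<le> c * real (card F)"
  shows "real (card (S \<inter> (+) g ` E)) \<le>
    c * real (card E) + (\<Sum>f\<in>F. real (card (E - (\<lambda>e. e + f) ` E))) / real (card F)"
proof -
  define n where "n f = card {e \<in> E. g + e + f \<in> S}" for f
  \<comment> \<open>For a point \<open>g + e'\<close> of \<open>S\<close> with \<open>e'\<close> in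
    \<open>E\<close>, either \<open>e' = e + f\<close> with \<open>e\<close> in \<open>E\<close>,
    and \<open>n f\<close> counts it, or \<open>e'\<close> lies outside the right translate of
    \<open>E\<close> by \<open>f\<close>.\<close>
  have *: "card (S \<inter> (+) g ` E) \<le> n f + card (E - (\<lambda>e. e + f) ` E)" for f
  proof -
    have "S \<inter> (+) g ` E \<subseteq>
        (\<lambda>e. g + e + f) ` {e \<in> E. g + e + f \<in> S} \<union> (+) g ` (E - (\<lambda>e. e + f) ` E)"
      by (auto simp: add.assoc)
    then have "card (S \<inter> (+) g ` E) \<le> card \<dots>"
      using \<open>finite E\<close> by (intro card_mono) auto
    also have "\<dots> \<le> card ((\<lambda>e. g + e + f) ` {e \<in> E. g + e + f \<in> S}) +
        card ((+) g ` (E - (\<lambda>e. e + f) ` E))"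
      by (rule card_Un_le)
    also have "\<dots> \<le> n f + card (E - (\<lambda>e. e + f) ` E)"
      using \<open>finite E\<close> unfolding n_def by (intro add_mono card_image_le) auto
    finally show ?thesis .
  qed
  have "(\<Sum>f\<in>F. n f) = (\<Sum>f\<in>F. \<Sum>e\<in>E. of_bool (g + e + f \<in> S))"
    using \<open>finite E\<close> by (simp add: n_def of_bool_def sum.If_cases Int_def)
  also have "\<dots> = (\<Sum>e\<in>E. \<Sum>f\<in>F. of_bool (g + e + f \<in> S))"
    by (rule sum.swap)
  also have "\<dots> = (\<Sum>e\<in>E. card (S \<inter> (+) (g + e) ` F))"
  proof (intro sum.cong refl)
    fix e
    have "S \<inter> (+) (g + e) ` F = (+) (g + e) ` {f \<in> F. g + e + f \<in> S}"
      by auto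
    then show "(\<Sum>f\<in>F. of_bool (g + e + f \<in> S)) = card (S \<inter> (+) (g + e) ` F)"
      using \<open>finite F\<close> by (simp add: card_translate of_bool_def sum.If_cases Int_def)
  qed
  finally have "real (\<Sum>f\<in>F. n f) = (\<Sum>e\<in>E. real (card (S \<inter> (+) (g + e) ` F)))"
    by simp
  also have "\<dots> \<le> (\<Sum>e\<in>E. c * real (card F))"
    by (intro sum_mono c)
  finally have n: "real (\<Sum>f\<in>F. n f) \<le> c * real (card F) * real (card E)"
    by (simp add: ac_simps)
  have "real (card F) * real (card (S \<inter> (+) g ` E)) = (\<Sum>f\<in>F. real (card (S \<inter> (+) g ` E)))"
    by simp
  also have "\<dots> \<le> (\<Sum>f\<in>F. real (n f) + real (card (E - (\<lambda>e. e + f) ` E)))"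
    using * by (intro sum_mono) (metis of_nat_add of_nat_mono)
  also have "\<dots> \<le> c * real (card F) * real (card E) +
      (\<Sum>f\<in>F. real (card (E - (\<lambda>e. e + f) ` E)))"
    using n by (simp add: sum.distrib)
  finally show ?thesis
    using assms(2,3) by (simp add: field_simps card_gt_0_iff)
qed

section \<open>Folner nets\<close>

text \<open>By directedness the tails form a filter base, so a single tail witnesses an eventual
  property.\<close>

lemma eventually_net_filter:
  assumes "directed_set I le"
  shows "eventually P (net_filter I le) \<longleftrightarrow> (\<exists>i\<in>I. \<forall>j\<in>I. le i j \<longrightarrow> P j)"
  unfolding net_filter_def
proof (subst eventually_INF_base)
  show "I \<noteq> {}"
    using assms by (simp add: directed_set_def)
  show "\<exists>x\<in>I. principal {j \<in> I. le x j} \<le>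
      inf (principal {j \<in> I. le a j}) (principal {j \<in> I. le b j})" if ab: "a \<in> I" "b \<in> I" for a b
  proof -
    obtain k where k: "k \<in> I" "le a k" "le b k"
      using assms ab unfolding directed_set_def by meson
    have "le a j" "le b j" if "j \<in> I" "le k j" for j
      using assms k ab that unfolding directed_set_def by meson+
    with k show ?thesis
      by (intro bexI[of _ k]) auto
  qed
qed (auto simp: eventually_principal)

lemma directed_set_refl: "directed_set I le \<Longrightarrow> i \<in> I \<Longrightarrow> le i i"
  by (simp add: directed_set_def)

lemma net_filter_neq_bot: "directed_set I le \<Longrightarrow> net_filter I le \<noteq> bot"
  using directed_set_refl[of I le] unfolding trivial_limit_def
  by (subst eventually_net_filter) blast+

lemma net_filter_sequentially: "net_filter UNIV (\<le>) = (sequentially :: nat filter)"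
  by (simp add: net_filter_def at_top_def atLeast_def)

lemma folner_netD:
  assumes "folner_net I le N"
  shows "eventually (\<lambda>i. finite (N i) \<and> N i \<noteq> {}) (net_filter I le)"
    and "((\<lambda>i. real (card (N i - (\<lambda>f. f + g) ` N i)) / real (card (N i))) \<longlongrightarrow> 0) (net_filter I le)"
    and "net_filter I le \<noteq> bot"
proof -
  have d: "directed_set I le" and f: "\<forall>i\<in>I. finite (N i) \<and> N i \<noteq> {}"
    using assms by (simp_all add: folner_net_def)
  from d obtain i where "i \<in> I"
    unfolding directed_set_def by blast
  with f show "eventually (\<lambda>i. finite (N i) \<and> N i \<noteq> {}) (net_filter I le)"
    unfolding eventually_net_filter[OF d] by blast
  show "net_filter I le \<noteq> bot"
    by (rule net_filter_neq_bot[OF d])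
qed (use assms in \<open>simp add: folner_net_def\<close>)

text \<open>This relative boundary is the error in every later comparison of a dimension with a
  density.\<close>

lemma folner_net_spread:
  assumes N: "folner_net I le N" and "finite K"
  shows "((\<lambda>i. real (card (spread K (N i) - N i)) / real (card (N i))) \<longlongrightarrow> 0) (net_filter I le)"
proof (rule tendsto_sandwich[where f = "\<lambda>_. 0" and
      h = "\<lambda>i. \<Sum>k\<in>K. real (card (N i - (\<lambda>f. f + k) ` N i)) / real (card (N i))"])
  show "((\<lambda>i. \<Sum>k\<in>K. real (card (N i - (\<lambda>f. f + k) ` N i)) / real (card (N i))) \<longlongrightarrow> 0)
      (net_filter I le)"
    by (rule tendsto_null_sum) (rule folner_netD[OF N])
  show "\<forall>\<^sub>F i in net_filter I le. real (card (spread K (N i) - N i)) / real (card (N i)) \<le>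
      (\<Sum>k\<in>K. real (card (N i - (\<lambda>f. f + k) ` N i)) / real (card (N i)))"
    using folner_netD(1)[OF N]
  proof eventually_elim
    case (elim i)
    then have "real (card (spread K (N i) - N i)) \<le> real (\<Sum>k\<in>K. card (N i - (\<lambda>f. f + k) ` N i))"
      using card_spread_diff_le[OF \<open>finite K\<close>] of_nat_mono by blast
    then show ?case
      by (simp flip: sum_divide_distrib add: divide_right_mono)
  qed
qed (intro always_eventually allI divide_nonneg_nonneg of_nat_0_le_iff, rule tendsto_const)

section \<open>Existence of the limit in the upper Banach density\<close>

text \<open>The supremum from the upper Banach density, taken in the reals to allow ordinary
  arithmetic. For finite \<open>F\<close> the frequencies lie between 0 and 1.\<close>

definition sup_frequency :: "'g::group_add set \<Rightarrow> 'g set \<Rightarrow> real" where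
  "sup_frequency S F = (SUP g. real (card (S \<inter> (+) g ` F)) / real (card F))"

lemma frequency_bounds:
  assumes "finite F"
  shows "0 \<le> real (card (S \<inter> (+) (g::'g::group_add) ` F)) / real (card F)"
    and "real (card (S \<inter> (+) g ` F)) / real (card F) \<le> 1"
proof -
  have "card (S \<inter> (+) g ` F) \<le> card ((+) g ` F)"
    using assms by (intro card_mono) auto
  then show "real (card (S \<inter> (+) g ` F)) / real (card F) \<le> 1"
    by (simp add: card_translate divide_le_eq)
qed simp

lemma frequency_le_sup:
  "finite F \<Longrightarrow> real (card (S \<inter> (+) g ` F)) / real (card F) \<le> sup_frequency S F"
  unfolding sup_frequency_def
  by (rule cSUP_upper[OF UNIV_I]) (rule bdd_aboveI2[where M = 1], rule frequency_bounds(2))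

lemma sup_frequency_nonneg: "finite F \<Longrightarrow> 0 \<le> sup_frequency S F"
  by (rule order_trans[OF frequency_bounds(1)[where g = 0] frequency_le_sup])

lemma ereal_sup_frequency:
  assumes "finite F"
  shows "ereal (sup_frequency S F) =
    (SUP g. ereal (real (card (S \<inter> (+) g ` F)) / real (card F)))"
  unfolding sup_frequency_def
proof (rule ereal_SUP, rule ereal_SUP_not_infty)
  show "\<forall>g\<in>UNIV. ereal 0 \<le> ereal (real (card (S \<inter> (+) g ` F)) / real (card F)) \<and>
      ereal (real (card (S \<inter> (+) g ` F)) / real (card F)) \<le> ereal 1"
    using frequency_bounds[OF assms] by simp
qed auto

text \<open>The limit is the infimum over all nonempty finite sets. The values stay above it because
  \<open>N i\<close> is eventually such a set, and averaging over a nearly optimal \<open>F\<close>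
  brings them below any larger number.\<close>

lemma sup_frequency_convergent:
  assumes N: "folner_net I le N"
  shows "\<exists>L. ((\<lambda>i. sup_frequency S (N i)) \<longlongrightarrow> L) (net_filter I le)"
proof
  define \<F> where "\<F> = {F :: 'b set. finite F \<and> F \<noteq> {}}"
  define L where "L = (INF F\<in>\<F>. sup_frequency S F)"
  have bdd: "bdd_below (sup_frequency S ` \<F>)"
    by (auto intro!: bdd_belowI2[where m = 0] sup_frequency_nonneg simp: \<F>_def)
  show "((\<lambda>i. sup_frequency S (N i)) \<longlongrightarrow> L) (net_filter I le)"
  proof (rule order_tendstoI)
    fix a assume "a < L"
    show "\<forall>\<^sub>F i in net_filter I le. a < sup_frequency S (N i)"
      using folner_netD(1)[OF N]
    proof eventually_elim
      case (elim i)
      then have "L \<le> sup_frequency S (N i)"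
        unfolding L_def by (intro cINF_lower bdd) (simp add: \<F>_def)
      with \<open>a < L\<close> show ?case
        by simp
    qed
  next
    fix a assume "L < a"
    moreover have "\<F> \<noteq> {}"
      by (auto simp: \<F>_def)
    ultimately obtain F where F: "finite F" "F \<noteq> {}" "sup_frequency S F < a"
      unfolding L_def using cINF_less_iff[OF _ bdd] by (auto simp: \<F>_def)
    \<comment> \<open>The error term of \<open>card_Int_translate_le\<close> relative to
      \<open>card (N i)\<close>: an average of finitely many Folner ratios, hence null.\<close>
    define e where "e i = (\<Sum>f\<in>F. real (card (N i - (\<lambda>x. x + f) ` N i)) / real (card (N i))) /
      real (card F)" for i
    have "(e \<longlongrightarrow> 0 / real (card F)) (net_filter I le)"
      unfolding e_def using F
      by (intro tendsto_divide tendsto_null_sum folner_netD[OF N] tendsto_const) auto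
    then have "\<forall>\<^sub>F i in net_filter I le. e i < a - sup_frequency S F"
      using F by (intro order_tendstoD(2)) auto
    then show "\<forall>\<^sub>F i in net_filter I le. sup_frequency S (N i) < a"
      using folner_netD(1)[OF N]
    proof eventually_elim
      case (elim i)
      have "real (card (S \<inter> (+) g ` F)) \<le> sup_frequency S F * real (card F)" for g
        using frequency_le_sup[of F S g] F by (simp add: field_simps card_gt_0_iff)
      from card_Int_translate_le[OF _ F(1,2) this, of "N i"] elim
      have "real (card (S \<inter> (+) g ` N i)) / real (card (N i)) \<le> sup_frequency S F + e i" for g
        by (simp add: e_def field_simps card_gt_0_iff flip: sum_divide_distrib)
      then have "sup_frequency S (N i) \<le> sup_frequency S F + e i"
        unfolding sup_frequency_def[of S "N i"] by (intro cSUP_least) auto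
      with elim show ?case
        by simp
    qed
  qed
qed

section \<open>Finitely supported configurations\<close>

definition delta :: "'g \<Rightarrow> 'a \<Rightarrow> 'g \<Rightarrow> 'a::zero" where
  "delta h a = (\<lambda>g. if g = h then a else 0)"

lemma restr_shift: "restr F (shift g x) = shift g (restr ((+) (- g) ` F) x)"
proof
  fix h
  have "h \<in> F \<longleftrightarrow> - g + h \<in> (+) (- g) ` F"
    by auto
  then show "restr F (shift g x) h = shift g (restr ((+) (- g) ` F) x) h"
    by (simp add: restr_def shift_def)
qed

lemma shift_minus_shift: "shift (- g) (shift g x) = x"
  by (simp add: shift_def flip: add.assoc)

lemma vector_space_fun_scale: "vector_space scale \<Longrightarrow> vector_space (fun_scale scale)"
  unfolding vector_space_def fun_scale_def by (simp add: fun_eq_iff)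

lemma (in vector_space) linear_restr: "Vector_Spaces.linear (fun_scale scale) (fun_scale scale) (restr F)"
  unfolding Vector_Spaces.linear_iff using vector_space_fun_scale[OF vector_space_axioms]
  by (auto simp: fun_scale_def restr_def fun_eq_iff)

lemma (in vector_space) linear_shift: "Vector_Spaces.linear (fun_scale scale) (fun_scale scale) (shift g)"
  unfolding Vector_Spaces.linear_iff using vector_space_fun_scale[OF vector_space_axioms]
  by (auto simp: fun_scale_def shift_def fun_eq_iff)

lemma (in vector_space) linear_delta: "Vector_Spaces.linear scale (fun_scale scale) (delta h)"
  unfolding Vector_Spaces.linear_iff using vector_space_fun_scale[OF vector_space_axioms] vector_space_axioms
  by (auto simp: fun_scale_def delta_def fun_eq_iff)

lemma sum_fun_eq: "(\<Sum>i\<in>A. f i) x = (\<Sum>i\<in>A. f i x)"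
  by (induction A rule: infinite_finite_induct) auto

lemma sum_delta:
  assumes "finite A" "\<And>h. h \<notin> A \<Longrightarrow> x h = 0"
  shows "(\<Sum>h\<in>A. delta h (x h)) = x"
  using assms by (auto simp: fun_eq_iff sum_fun_eq delta_def)

text \<open>For a basis \<open>B\<close> of the value space this is the standard basis of the
  finitely supported configurations vanishing outside \<open>T\<close>.\<close>

definition units :: "'a set \<Rightarrow> 'g set \<Rightarrow> ('g \<Rightarrow> 'a::zero) set" where
  "units B T = (\<lambda>(h, b). delta h b) ` (T \<times> B)"

context finite_dimensional_vector_space
begin

interpretation conf: vector_space "fun_scale scale :: 'a \<Rightarrow> ('g \<Rightarrow> 'b) \<Rightarrow> 'g \<Rightarrow> 'b"
  by (rule vector_space_fun_scale) (rule vector_space_axioms)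

text \<open>Linear combinations are finite sums, which forces finite support; conversely such a
  configuration is the sum of its values placed at single points. This translates statements about
  asymptotic pairs into statements about spans.\<close>

lemma span_units:
  "conf.span (units Basis T) = {x. finite {h. x h \<noteq> 0} \<and> x \<in> vanishing_on (- T)}" (is "_ = ?V")
proof
  have "conf.subspace ?V"
  proof (rule conf.subspaceI)
    fix x y assume xy: "x \<in> ?V" "y \<in> ?V"
    have "{h. (x + y) h \<noteq> 0} \<subseteq> {h. x h \<noteq> 0} \<union> {h. y h \<noteq> 0}"
      by auto
    then show "x + y \<in> ?V"
      using xy by (auto simp: vanishing_on_def intro: finite_subset)
  next
    fix c x assume x: "x \<in> ?V"
    have "{h. fun_scale scale c x h \<noteq> 0} \<subseteq> {h. x h \<noteq> 0}"
      by (auto simp: fun_scale_def)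
    then show "fun_scale scale c x \<in> ?V"
      using x by (auto simp: vanishing_on_def fun_scale_def intro: finite_subset)
  qed (simp add: vanishing_on_def)
  moreover have "units Basis T \<subseteq> ?V"
    by (auto simp: units_def delta_def vanishing_on_def)
  ultimately show "conf.span (units Basis T) \<subseteq> ?V"
    by (rule conf.span_minimal[rotated])
  show "?V \<subseteq> conf.span (units Basis T)"
  proof
    fix x assume x: "x \<in> ?V"
    define A where "A = {h. x h \<noteq> 0}"
    have "delta h (x h) \<in> conf.span (units Basis T)" if "h \<in> A" for h
    proof -
      interpret d: Vector_Spaces.linear scale "fun_scale scale" "delta h"
        by (rule linear_delta)
      have "delta h (x h) \<in> conf.span (delta h ` Basis)"
        using span_Basis by (simp add: d.span_image)
      also have "\<dots> \<subseteq> conf.span (units Basis T)"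
        using x that by (intro conf.span_mono) (auto simp: A_def units_def vanishing_on_def)
      finally show ?thesis .
    qed
    then have "(\<Sum>h\<in>A. delta h (x h)) \<in> conf.span (units Basis T)"
      by (rule conf.span_sum)
    also have "(\<Sum>h\<in>A. delta h (x h)) = x"
      using x by (intro sum_delta) (auto simp: A_def)
    finally show "x \<in> conf.span (units Basis T)" .
  qed
qed

lemma inj_on_delta: "inj_on (\<lambda>(h, b). delta h b) (T \<times> Basis)"
proof -
  \<comment> \<open>A zero basis vector would break injectivity, since \<open>delta h 0\<close> does
    not depend on \<open>h\<close>.\<close>
  have "0 \<notin> Basis"
    using dependent_zero independent_Basis by blast
  then show ?thesis
    by (auto simp: inj_on_def delta_def fun_eq_iff split: if_splits)
qed

lemma card_units: "card (units Basis T) = card T * card Basis"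
  by (simp add: units_def card_image[OF inj_on_delta] card_cartesian_product)

lemma finite_units: "finite T \<Longrightarrow> finite (units Basis T)"
  by (simp add: units_def finite_Basis)

text \<open>Evaluating a vanishing combination at a point \<open>h\<close> leaves a vanishing
  combination of \<open>Basis\<close>, with the coefficients of the units at
  \<open>h\<close>.\<close>

lemma independent_units:
  assumes "finite T"
  shows "conf.independent (units Basis T)"
proof (rule conf.independent_if_scalars_zero)
  fix f x
  assume 0: "(\<Sum>x\<in>units Basis T. fun_scale scale (f x) x) = 0" and "x \<in> units Basis T"
  then obtain h b where x: "h \<in> T" "b \<in> Basis" "x = delta h b"
    by (auto simp: units_def)
  have "0 = (\<Sum>x\<in>units Basis T. fun_scale scale (f x) x) h"
    by (simp add: 0)
  also have "\<dots> = (\<Sum>(k, b)\<in>T \<times> Basis. scale (f (delta k b)) (delta k b h))"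
    unfolding units_def sum.reindex[OF inj_on_delta] sum_fun_eq
    by (intro sum.cong refl) (auto simp: fun_scale_def)
  also have "\<dots> = (\<Sum>k\<in>T. \<Sum>b\<in>Basis. if k = h then scale (f (delta h b)) b else 0)"
    unfolding sum.cartesian_product[symmetric] by (intro sum.cong refl) (auto simp: delta_def)
  also have "\<dots> = (\<Sum>b\<in>Basis. scale (f (delta h b)) b)"
    using assms x(1) by (subst sum.swap) simp
  finally show "f x = 0"
    using independentD[OF independent_Basis finite_Basis subset_refl, of "\<lambda>b. f (delta h b)" b] x
    by simp
qed (rule finite_units[OF assms])

section \<open>Dimension of restrictions to finite windows\<close>

lemma restr_image_subset_span_units: "finite F \<Longrightarrow> restr F ` X \<subseteq> conf.span (units Basis F)"
  unfolding span_units by (auto simp: restr_def vanishing_on_def)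

text \<open>The space of all configurations may have infinite dimension; the basis is finite because
  the restrictions lie in the span of finitely many units.\<close>

lemma dim_on_basis:
  assumes "finite F"
  obtains B where "finite B" "conf.independent B" "B \<subseteq> restr F ` X"
    "restr F ` X \<subseteq> conf.span B" "card B = dim_on scale F X"
proof -
  obtain B where B: "B \<subseteq> restr F ` X" "conf.independent B" "restr F ` X \<subseteq> conf.span B"
      "card B = conf.dim (restr F ` X)"
    using conf.basis_exists by blast
  moreover have "finite B"
    using conf.independent_span_bound[OF finite_units[OF assms] B(2)] B(1)
      restr_image_subset_span_units[OF assms, of X] by blast
  ultimately show ?thesis
    using that by (simp add: dim_on_def)
qed

lemma card_le_dim_on:
  assumes "finite F" "conf.independent C" "C \<subseteq> restr F ` X"
  shows "card C \<le> dim_on scale F X"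
proof -
  obtain B where B: "finite B" "restr F ` X \<subseteq> conf.span B" "card B = dim_on scale F X"
    using dim_on_basis[OF assms(1)] by metis
  have "card C \<le> card B"
    using conf.independent_span_bound[OF B(1) assms(2)] assms(3) B(2) by blast
  then show ?thesis
    by (simp add: B)
qed

text \<open>Each new site contributes at most the dimension of the value space: the restriction to
  \<open>E\<close> splits into a linear image of the restriction to \<open>F\<close> and a part
  supported on \<open>E - F\<close>.\<close>

lemma dim_on_le:
  assumes "finite E" "finite F"
  shows "dim_on scale E X \<le> dim_on scale F X + card (E - F) * card Basis"
proof -
  obtain B where B: "finite B" "restr F ` X \<subseteq> conf.span B" "card B = dim_on scale F X"
    using dim_on_basis[OF assms(2)] by metis
  interpret r: Vector_Spaces.linear "fun_scale scale" "fun_scale scale" "restr E"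
    by (rule linear_restr)
  let ?W = "restr E ` B \<union> units Basis (E - F)"
  have "restr E ` X \<subseteq> conf.span ?W"
  proof (rule image_subsetI)
    fix x assume "x \<in> X"
    then have "restr E (restr F x) \<in> conf.span (restr E ` B)"
      using B(2) by (auto simp: r.span_image)
    then have "restr E (restr F x) \<in> conf.span ?W"
      using conf.span_mono[of "restr E ` B" ?W] by blast
    moreover have "restr (E - F) x \<in> conf.span ?W"
      using restr_image_subset_span_units[of "E - F" "{x}"] assms
        conf.span_mono[of "units Basis (E - F)" ?W] by auto
    moreover have "restr E x = restr E (restr F x) + restr (E - F) x"
      by (auto simp: restr_def fun_eq_iff)
    ultimately show "restr E x \<in> conf.span ?W"
      by (simp add: conf.span_add)
  qed
  then have "dim_on scale E X \<le> card ?W"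
    unfolding dim_on_def using B(1) assms by (intro conf.dim_le_card) (auto intro: finite_units)
  also have "\<dots> \<le> card (restr E ` B) + card (units Basis (E - F))"
    by (rule card_Un_le)
  also have "\<dots> \<le> dim_on scale F X + card (E - F) * card Basis"
    using B card_image_le[OF B(1), of "restr E"] by (simp add: card_units)
  finally show ?thesis .
qed

lemma dim_on_shift_le:
  assumes "finite F"
  shows "dim_on scale F (shift g ` X) \<le> dim_on scale ((+) (- g) ` F) X"
proof -
  obtain B where B: "finite B" "restr ((+) (- g) ` F) ` X \<subseteq> conf.span B"
      "card B = dim_on scale ((+) (- g) ` F) X"
    using dim_on_basis[OF finite_imageI[OF assms]] by metis
  interpret s: Vector_Spaces.linear "fun_scale scale" "fun_scale scale" "shift g"
    by (rule linear_shift)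
  have "restr F ` shift g ` X \<subseteq> conf.span (shift g ` B)"
    using B(2) by (auto simp: restr_shift s.span_image)
  then have "dim_on scale F (shift g ` X) \<le> card (shift g ` B)"
    unfolding dim_on_def using B(1) by (intro conf.dim_le_card) auto
  also have "\<dots> \<le> card B"
    by (rule card_image_le[OF B(1)])
  finally show ?thesis
    by (simp add: B)
qed

text \<open>This trades shifts of the configuration space for translates of the window. The missing
  inequality is \<open>dim_on_shift_le\<close> for the inverse shift.\<close>

lemma dim_on_shift:
  assumes "finite F"
  shows "dim_on scale F (shift g ` X) = dim_on scale ((+) (- g) ` F) X"
proof (rule antisym)
  have "dim_on scale ((+) (- g) ` F) (shift (- g) ` shift g ` X) \<le>
      dim_on scale ((+) (- (- g)) ` (+) (- g) ` F) (shift g ` X)"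
    by (rule dim_on_shift_le) (simp add: assms)
  then show "dim_on scale ((+) (- g) ` F) X \<le> dim_on scale F (shift g ` X)"
    by (simp add: image_image shift_minus_shift add.assoc[symmetric])
qed (rule dim_on_shift_le[OF assms])

end

section \<open>Linear maps with finite memory\<close>

text \<open>Only linearity and locality of the automaton are kept. With \<open>K\<close> closed
  under inverses, the same set bounds the sites on which a value depends and the sites that a point
  can influence.\<close>

locale linear_local_map = finite_dimensional_vector_space scale Basis
  for scale :: "'k::field \<Rightarrow> 'a::ab_group_add \<Rightarrow> 'a" and Basis +
  fixes \<tau> :: "('g::group_add \<Rightarrow> 'a) \<Rightarrow> 'g \<Rightarrow> 'a" and K :: "'g set"
  assumes finite_K: "finite K"
    and uminus_K: "k \<in> K \<Longrightarrow> - k \<in> K"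
    and linear: "Vector_Spaces.linear (fun_scale scale) (fun_scale scale) \<tau>"
    and local: "(\<And>k. k \<in> K \<Longrightarrow> x (g + k) = y (g + k)) \<Longrightarrow> \<tau> x g = \<tau> y g"
begin

sublocale conf: vector_space "fun_scale scale :: 'k \<Rightarrow> ('g \<Rightarrow> 'a) \<Rightarrow> 'g \<Rightarrow> 'a"
  by (rule vector_space_fun_scale) (rule vector_space_axioms)

sublocale \<tau>: Vector_Spaces.linear "fun_scale scale" "fun_scale scale" \<tau>
  by (rule linear)

text \<open>If \<open>g\<close> sees a site \<open>g + k\<close> of \<open>F\<close>, then
  \<open>g\<close> is that site plus \<open>- k\<close>, and \<open>- k\<close> is again in
  \<open>K\<close>.\<close>

lemma image_vanishing_on:
  assumes "x \<in> vanishing_on (- F)"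
  shows "\<tau> x \<in> vanishing_on (- spread K F)"
proof -
  have "\<tau> x g = 0" if "g \<notin> spread K F" for g
  proof -
    have "g + k \<notin> F" if "k \<in> K" for k
    proof
      assume "g + k \<in> F"
      from in_spreadI[OF this uminus_K[OF that]] \<open>g \<notin> spread K F\<close> show False
        by (simp add: add.assoc)
    qed
    then have "\<tau> x g = \<tau> 0 g"
      using assms by (intro local) (auto simp: vanishing_on_def)
    then show ?thesis
      by simp
  qed
  then show ?thesis
    by (simp add: vanishing_on_def)
qed

lemma restr_image_restr: "restr F (\<tau> (restr (spread K F) x)) = restr F (\<tau> x)"
proof
  fix g
  have "\<tau> (restr (spread K F) x) g = \<tau> x g" if "g \<in> F"
    by (rule local) (simp add: restr_def in_spreadI[OF that])
  then show "restr F (\<tau> (restr (spread K F) x)) g = restr F (\<tau> x) g"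
    by (simp add: restr_def)
qed

text \<open>By linearity only the differences of asymptotic configurations matter, and these have
  finite support even when the configurations do not.\<close>

lemma pre_injective_iff_inj_on:
  "pre_injective_on \<tau> (vanishing_on S) \<longleftrightarrow> inj_on \<tau> (conf.span (units Basis (- S)))"
proof
  assume "pre_injective_on \<tau> (vanishing_on S)"
  then have pre: "x = y" if "x \<in> vanishing_on S" "y \<in> vanishing_on S" "asymptotic x y" "\<tau> x = \<tau> y" for x y
    using that by (auto simp: pre_injective_on_def)
  show "inj_on \<tau> (conf.span (units Basis (- S)))"
  proof (rule inj_onI)
    fix x y
    assume xy: "x \<in> conf.span (units Basis (- S))" "y \<in> conf.span (units Basis (- S))" "\<tau> x = \<tau> y"
    have "{h. x h \<noteq> y h} \<subseteq> {h. x h \<noteq> 0} \<union> {h. y h \<noteq> 0}"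
      by auto
    with xy have "asymptotic x y"
      unfolding asymptotic_def by (auto simp: span_units intro: finite_subset)
    with xy show "x = y"
      by (simp add: pre span_units)
  qed
next
  assume inj: "inj_on \<tau> (conf.span (units Basis (- S)))"
  show "pre_injective_on \<tau> (vanishing_on S)"
    unfolding pre_injective_on_def
  proof safe
    fix x y assume xy: "x \<in> vanishing_on S" "y \<in> vanishing_on S" "asymptotic x y" "\<tau> x = \<tau> y"
    have "x - y \<in> conf.span (units Basis (- S))"
      using xy(1-3) by (auto simp: span_units vanishing_on_def asymptotic_def)
    moreover have "\<tau> (x - y) = \<tau> 0"
      by (simp add: \<tau>.diff xy(4))
    ultimately have "x - y = 0"
      using inj_onD[OF inj] conf.span_zero by blast
    then show "x = y"
      by simp
  qed
qed

text \<open>The units on \<open>F - S\<close> have independent images, all visible on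
  \<open>spread K F\<close>. Shrinking this window back to \<open>F\<close> costs at most the
  boundary term.\<close>

lemma pre_injective_card_le:
  assumes "pre_injective_on \<tau> (vanishing_on S)" "finite F"
  shows "card (F - S) * card Basis \<le>
    dim_on scale F (range \<tau>) + card (spread K F - F) * card Basis"
proof -
  have "conf.span (units Basis (F - S)) \<subseteq> conf.span (units Basis (- S))"
    by (rule conf.span_mono) (auto simp: units_def)
  with assms(1) have inj: "inj_on \<tau> (conf.span (units Basis (F - S)))"
    unfolding pre_injective_iff_inj_on by (rule inj_on_subset)
  have "card (F - S) * card Basis = card (\<tau> ` units Basis (F - S))"
    using card_image[OF inj_on_subset[OF inj conf.span_superset]] by (simp add: card_units)
  also have "\<dots> \<le> dim_on scale (spread K F) (range \<tau>)"
  proof (rule card_le_dim_on)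
    show "finite (spread K F)"
      by (simp add: finite_spread finite_K assms)
    show "conf.independent (\<tau> ` units Basis (F - S))"
      using assms(2) by (intro \<tau>.independent_injective_image inj independent_units) simp
    \<comment> \<open>These images vanish outside \<open>spread K F\<close>, so each equals its own
      restriction.\<close>
    show "\<tau> ` units Basis (F - S) \<subseteq> restr (spread K F) ` range \<tau>"
    proof (rule image_subsetI)
      fix u :: "'g \<Rightarrow> 'a" assume "u \<in> units Basis (F - S)"
      then have "u \<in> vanishing_on (- F)"
        by (auto simp: units_def delta_def vanishing_on_def)
      from image_vanishing_on[OF this] have "\<tau> u = restr (spread K F) (\<tau> u)"
        by (auto simp: vanishing_on_def restr_def fun_eq_iff)
      then show "\<tau> u \<in> restr (spread K F) ` range \<tau>"
        by blast
    qed
  qed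
  also have "\<dots> \<le> dim_on scale F (range \<tau>) + card (spread K F - F) * card Basis"
    by (rule dim_on_le) (simp_all add: finite_spread finite_K assms)
  finally show ?thesis .
qed

text \<open>The complement of \<open>S\<close> indexes a maximal linearly independent set of columns of \<open>\<tau>\<close>. Only
  columns indexed by \<open>spread K F\<close> are nonzero on \<open>F\<close>, so those outside \<open>S\<close> span all restrictions
  to \<open>F\<close>.\<close>

lemma exists_pre_injective_dim_on_le:
  assumes "card Basis = 1"
  obtains S where "pre_injective_on \<tau> (vanishing_on S)"
    and "\<And>F. finite F \<Longrightarrow> dim_on scale F (range \<tau>) \<le> card (spread K F - S)"
proof -
  obtain b where b: "Basis = {b}"
    using assms card_1_singletonE by blast
  define col where "col h = \<tau> (delta h b)" for h
  have units: "units Basis T = (\<lambda>h. delta h b) ` T" for T :: "'g set"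
    by (auto simp: units_def b)
  have cols: "\<tau> ` units Basis T = col ` T" for T
    by (simp add: units col_def image_image)
  obtain C where C: "C \<subseteq> range col" "conf.independent C" "range col \<subseteq> conf.span C"
    using conf.maximal_independent_subset by blast
  \<comment> \<open>Different sites may have equal columns, so one index is selected for each member
    of \<open>C\<close>.\<close>
  then obtain T where T: "inj_on col T" "C = col ` T"
    unfolding subset_image_inj by blast
  show ?thesis
  proof (rule that[of "- T"])
    have "inj_on \<tau> (units Basis T)"
      using T(1) unfolding units by (auto simp: inj_on_def col_def)
    then have "inj_on \<tau> (conf.span (units Basis T))"
      using C(2) by (subst \<tau>.inj_on_span_iff_independent_image) (simp_all add: cols T)
    then show "pre_injective_on \<tau> (vanishing_on (- T))"
      by (simp add: pre_injective_iff_inj_on)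
  next
    fix F :: "'g set" assume F: "finite F"
    interpret r: Vector_Spaces.linear "fun_scale scale" "fun_scale scale" "restr F"
      by (rule linear_restr)
    let ?W = "restr F ` col ` (spread K F \<inter> T)"
    have fin: "finite (spread K F)"
      by (simp add: finite_spread finite_K F)
    have "restr F (col h) \<in> conf.span ?W" if "h \<in> T" for h
    proof (cases "h \<in> spread K F")
      case True
      with that show ?thesis
        by (intro conf.span_base) auto
    next
      case False
      then have "restr (spread K F) (delta h b) = 0"
        by (auto simp: restr_def delta_def fun_eq_iff)
      with restr_image_restr[of F "delta h b"] have "restr F (col h) = 0"
        by (simp add: col_def)
      then show ?thesis
        by (simp add: conf.span_zero)
    qed
    then have "conf.span (restr F ` C) \<subseteq> conf.span ?W"
      by (intro conf.span_minimal) (auto simp: T)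
    \<comment> \<open>For infinitely supported \<open>x\<close> the image need not be a finite
      combination of columns. Truncating \<open>x\<close> to \<open>spread K F\<close> first leaves
      the values on \<open>F\<close> unchanged and makes the combination finite.\<close>
    moreover have "restr F (\<tau> x) \<in> conf.span (restr F ` C)" for x
    proof -
      have "restr (spread K F) x \<in> conf.span (units Basis (spread K F))"
        using restr_image_subset_span_units[OF fin, of "{x}"] by simp
      then have "\<tau> (restr (spread K F) x) \<in> conf.span (col ` spread K F)"
        by (auto simp: \<tau>.span_image simp flip: cols)
      also have "\<dots> \<subseteq> conf.span C"
        using C(3) by (intro conf.span_minimal) auto
      finally have "restr F (\<tau> (restr (spread K F) x)) \<in> conf.span (restr F ` C)"
        by (simp add: r.span_image)
      then show ?thesis
        by (simp add: restr_image_restr)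
    qed
    ultimately have "restr F ` range \<tau> \<subseteq> conf.span ?W"
      by auto
    then have "dim_on scale F (range \<tau>) \<le> card ?W"
      unfolding dim_on_def using fin by (intro conf.dim_le_card) auto
    also have "\<dots> \<le> card (spread K F \<inter> T)"
      using fin by (intro order_trans[OF card_image_le card_image_le]) auto
    finally show "dim_on scale F (range \<tau>) \<le> card (spread K F - - T)"
      by (simp add: Diff_eq)
  qed
qed

end

lemma (in finite_dimensional_vector_space) linear_local_map_if_linear_nuca:
  assumes "linear_nuca scale \<tau>"
  shows "\<exists>K. linear_local_map scale Basis \<tau> K"
proof -
  obtain M s where M: "finite M"
    and s: "\<And>g. Vector_Spaces.linear (fun_scale scale) scale (s g)"
    and \<tau>: "\<And>x g. \<tau> x g = s g (restr M (shift (- g) x))"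
    using assms unfolding linear_nuca_def by blast
  have lin: "Vector_Spaces.linear (fun_scale scale) scale (\<lambda>x. \<tau> x g)" for g
  proof -
    have "(\<lambda>x. \<tau> x g) = s g \<circ> (restr M \<circ> shift (- g))"
      by (simp add: \<tau> fun_eq_iff)
    then show ?thesis
      using Vector_Spaces.linear_compose[OF
          Vector_Spaces.linear_compose[OF linear_shift[of "- g"] linear_restr[of M]] s[of g]]
      by simp
  qed
  \<comment> \<open>Adjoining the inverses makes the memory set symmetric; locality with respect to
    a larger set is a weaker demand.\<close>
  have "linear_local_map scale Basis \<tau> (M \<union> uminus ` M)"
  proof (intro linear_local_map.intro linear_local_map_axioms.intro)
    show "finite_dimensional_vector_space scale Basis"
      by (rule finite_dimensional_vector_space_axioms)
    show "finite (M \<union> uminus ` M)"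
      using M by simp
    show "- k \<in> M \<union> uminus ` M" if "k \<in> M \<union> uminus ` M" for k
      using that by auto
    show "Vector_Spaces.linear (fun_scale scale) (fun_scale scale) \<tau>"
      using lin vector_space_fun_scale[OF vector_space_axioms]
      unfolding Vector_Spaces.linear_iff by (auto simp: fun_eq_iff fun_scale_def)
    show "\<tau> x g = \<tau> y g" if "\<And>k. k \<in> M \<union> uminus ` M \<Longrightarrow> x (g + k) = y (g + k)" for x y g
    proof -
      have "restr M (shift (- g) x) = restr M (shift (- g) y)"
        using that by (auto simp: restr_def shift_def fun_eq_iff)
      then show ?thesis
        by (simp add: \<tau>)
    qed
  qed
  then show ?thesis ..
qed

section \<open>Mean dimension of the image\<close>

context linear_local_map
begin

text \<open>Divide \<open>pre_injective_card_le\<close> by \<open>card (F i)\<close> and pass to the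
  upper limit; the boundary term vanishes.\<close>

lemma upper_mdim_image_ge:
  assumes pre: "pre_injective_on \<tau> (vanishing_on S)" and "folner_seq F"
  shows "(1 - upper_density F S) * ereal (real (card Basis)) \<le> upper_mdim scale F (range \<tau>)"
proof -
  define D where "D = real (card Basis)"
  define r where "r i = real (dim_on scale (F i) (range \<tau>)) / real (card (F i))" for i
  define p where "p i = real (card (S \<inter> F i)) / real (card (F i))" for i
  define e where "e i = real (card (spread K (F i) - F i)) / real (card (F i))" for i
  have F: "folner_net UNIV (\<le>) F"
    using assms(2) by (simp add: folner_seq_def)
  then have fin: "finite (F i)" "F i \<noteq> {}" for i
    by (simp_all add: folner_net_def)
  have e: "e \<longlonglongrightarrow> 0"
    using folner_net_spread[OF F finite_K] by (simp add: e_def[abs_def] net_filter_sequentially)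
  have p: "0 \<le> p i" "p i \<le> 1" for i
    using frequency_bounds[OF fin(1)[of i], of S 0] by (simp_all add: p_def)
  have bound: "(1 - p i - e i) * D \<le> r i" for i
  proof -
    have pos: "0 < real (card (F i))"
      using fin by (simp add: card_gt_0_iff)
    have "real (card (F i - S)) = real (card (F i)) - real (card (S \<inter> F i))"
      using card_Int_Diff[OF fin(1)[of i], of S] by (simp add: Int_commute)
    moreover have "real (card (F i - S)) * D \<le>
        real (dim_on scale (F i) (range \<tau>)) + real (card (spread K (F i) - F i)) * D"
      using pre_injective_card_le[OF pre fin(1)[of i]]
      unfolding D_def by (simp flip: of_nat_mult of_nat_add)
    ultimately have "(real (card (F i)) - real (card (S \<inter> F i)) - real (card (spread K (F i) - F i))) * D
        \<le> real (dim_on scale (F i) (range \<tau>))"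
      by (simp add: left_diff_distrib)
    then have "(real (card (F i)) - real (card (S \<inter> F i)) - real (card (spread K (F i) - F i))) * D /
        real (card (F i)) \<le> r i"
      unfolding r_def by (rule divide_right_mono) simp
    moreover have "(1 - p i - e i) * D =
        (real (card (F i)) - real (card (S \<inter> F i)) - real (card (spread K (F i) - F i))) * D /
        real (card (F i))"
      using pos by (simp add: p_def e_def field_simps)
    ultimately show ?thesis
      by simp
  qed
  \<comment> \<open>Being between 0 and 1, the density is a real number \<open>u\<close>, so the
    estimates can be made in the reals.\<close>
  have "0 \<le> limsup (\<lambda>i. ereal (p i))" "limsup (\<lambda>i. ereal (p i)) \<le> 1"
    by (auto intro!: le_Limsup Limsup_bounded always_eventually simp: p)
  then obtain u where u: "limsup (\<lambda>i. ereal (p i)) = ereal u"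
    by (cases "limsup (\<lambda>i. ereal (p i))") auto
  have "ereal ((1 - u) * D) \<le> limsup (\<lambda>i. ereal (r i))"
  proof (rule ereal_le_epsilon2)
    fix \<epsilon> :: real assume "0 < \<epsilon>"
    \<comment> \<open>The density and the boundary may each be off by \<open>\<delta>\<close>, at a
      total cost of \<open>2 * \<delta> * D\<close>. The added 1 covers the case
      \<open>D = 0\<close>.\<close>
    define \<delta> where "\<delta> = \<epsilon> / (2 * D + 1)"
    have D: "0 \<le> D"
      by (simp add: D_def)
    with \<open>0 < \<epsilon>\<close> have "0 < \<delta>"
      by (simp add: \<delta>_def)
    have "2 * \<delta> * D \<le> \<epsilon>"
      using D \<open>0 < \<epsilon>\<close> by (simp add: \<delta>_def field_simps)
    have "limsup (\<lambda>i. ereal (p i)) < ereal (u + \<delta>)"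
      using \<open>0 < \<delta>\<close> by (simp add: u)
    then have "\<forall>\<^sub>F i in sequentially. ereal (p i) < ereal (u + \<delta>)"
      by (rule Limsup_lessD)
    moreover have "\<forall>\<^sub>F i in sequentially. e i < \<delta>"
      using e \<open>0 < \<delta>\<close> by (rule order_tendstoD(2))
    ultimately have "\<forall>\<^sub>F i in sequentially. ereal ((1 - u) * D - \<epsilon>) \<le> ereal (r i)"
    proof eventually_elim
      case (elim i)
      then have "(1 - u - 2 * \<delta>) * D \<le> (1 - p i - e i) * D"
        using D by (intro mult_right_mono) auto
      with bound[of i] \<open>2 * \<delta> * D \<le> \<epsilon>\<close> show ?case
        by (simp add: algebra_simps)
    qed
    then have "ereal ((1 - u) * D - \<epsilon>) \<le> limsup (\<lambda>i. ereal (r i))"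
      by (intro le_Limsup) simp_all
    then show "ereal ((1 - u) * D) \<le> limsup (\<lambda>i. ereal (r i)) + ereal \<epsilon>"
      by (cases "limsup (\<lambda>i. ereal (r i))") auto
  qed
  then show ?thesis
    by (simp add: upper_mdim_def upper_density_def u one_ereal_def
        flip: r_def p_def D_def)
qed

text \<open>For \<open>S\<close> from a maximal independent set of columns, independence and
  spanning squeeze the dimension on every translated window around the number of its sites outside
  \<open>S\<close>. The error is uniform in the translate, so the infimum of dimensions becomes 1
  minus the supremum of frequencies.\<close>

lemma exists_pre_injective_lower_Banach_mdim:
  assumes N: "folner_net I le N" and "card Basis = 1"
  obtains S L where "pre_injective_on \<tau> (vanishing_on S)"
    and "upper_Banach_density I le N S = ereal L"
    and "lower_Banach_mdim scale I le N (range \<tau>) = ereal (1 - L)"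
proof -
  obtain S where pre: "pre_injective_on \<tau> (vanishing_on S)"
    and dim_le: "\<And>F. finite F \<Longrightarrow> dim_on scale F (range \<tau>) \<le> card (spread K F - S)"
    using exists_pre_injective_dim_on_le[OF assms(2)] by blast
  obtain L where L: "((\<lambda>i. sup_frequency S (N i)) \<longlongrightarrow> L) (net_filter I le)"
    using sup_frequency_convergent[OF N] by blast
  define e where "e i = real (card (spread K (N i) - N i)) / real (card (N i))" for i
  have e: "(e \<longlongrightarrow> 0) (net_filter I le)"
    using folner_net_spread[OF N finite_K] by (simp add: e_def[abs_def])
  define m where "m i g = real (dim_on scale (N i) (shift g ` range \<tau>)) / real (card (N i))" for i g
  define p where "p i g = real (card (S \<inter> (+) g ` N i)) / real (card (N i))" for i g
  \<comment> \<open>Shifting by \<open>g\<close> amounts to translating the window by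
    \<open>- g\<close>. The boundary has the same size for all translates, so \<open>e i\<close> is
    independent of \<open>g\<close>.\<close>
  have m: "1 - p i (- g) - e i \<le> m i g" "m i g \<le> 1 - p i (- g) + e i"
    if fin: "finite (N i)" "N i \<noteq> {}" for i g
  proof -
    define F where "F = (+) (- g) ` N i"
    have "finite F"
      using fin by (simp add: F_def)
    have pos: "0 < real (card (N i))"
      using fin by (simp add: card_gt_0_iff)
    have dim: "dim_on scale (N i) (shift g ` range \<tau>) = dim_on scale F (range \<tau>)"
      unfolding F_def by (rule dim_on_shift[OF fin(1)])
    have spread: "card (spread K F - F) = card (spread K (N i) - N i)"
      by (simp add: F_def card_spread_diff_translate)
    have card: "real (card (F - S)) = real (card (N i)) - real (card (S \<inter> F))"
      using card_Int_Diff[OF \<open>finite F\<close>, of S] card_translate[of "- g" "N i"]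
      by (simp add: Int_commute F_def)
    have "card (F - S) \<le> dim_on scale F (range \<tau>) + card (spread K F - F)"
      using pre_injective_card_le[OF pre \<open>finite F\<close>] assms(2) by simp
    then have lower: "real (card (N i)) - real (card (S \<inter> F)) - real (card (spread K (N i) - N i)) \<le>
        real (dim_on scale F (range \<tau>))"
      using card spread by linarith
    have "spread K F - S \<subseteq> (F - S) \<union> (spread K F - F)"
      by auto
    then have "card (spread K F - S) \<le> card ((F - S) \<union> (spread K F - F))"
      using \<open>finite F\<close> by (intro card_mono) (auto intro: finite_spread finite_K)
    also have "\<dots> \<le> card (F - S) + card (spread K F - F)"
      by (rule card_Un_le)
    finally have upper: "real (dim_on scale F (range \<tau>)) \<le>
        real (card (N i)) - real (card (S \<inter> F)) + real (card (spread K (N i) - N i))"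
      using dim_le[OF \<open>finite F\<close>] card spread by linarith
    show "1 - p i (- g) - e i \<le> m i g" "m i g \<le> 1 - p i (- g) + e i"
      using divide_right_mono[OF lower, of "real (card (N i))"]
        divide_right_mono[OF upper, of "real (card (N i))"] pos
      by (simp_all add: m_def p_def e_def dim diff_divide_distrib add_divide_distrib flip: F_def)
  qed
  have a_def: "sup_frequency S (N i) = (SUP g. p i g)" for i
    by (simp add: sup_frequency_def p_def)
  have inf_bounds: "\<forall>\<^sub>F i in net_filter I le.
      ereal (1 - sup_frequency S (N i) - e i) \<le> (INF g. ereal (m i g)) \<and>
      (INF g. ereal (m i g)) \<le> ereal (1 - sup_frequency S (N i) + e i)"
    using folner_netD(1)[OF N]
  proof eventually_elim
    case (elim i)
    then have fin: "finite (N i)" "N i \<noteq> {}"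
      by auto
    have lower: "ereal (1 - sup_frequency S (N i) - e i) \<le> (INF g. ereal (m i g))"
    proof (rule INF_greatest)
      fix g
      show "ereal (1 - sup_frequency S (N i) - e i) \<le> ereal (m i g)"
        using m(1)[OF fin, of g] frequency_le_sup[OF fin(1), of S "- g"] by (simp add: p_def)
    qed
    \<comment> \<open>Bounded below by a real and above by one of its terms, the infimum is a real
      \<open>b\<close>.\<close>
    moreover have "(INF g. ereal (m i g)) \<le> ereal (m i 0)"
      by (rule INF_lower) simp
    ultimately obtain b where b: "(INF g. ereal (m i g)) = ereal b"
      by (cases "INF g. ereal (m i g)") auto
    \<comment> \<open>As \<open>- g\<close> ranges over the whole group, the bounds on all
      \<open>m i (- g)\<close> control every frequency \<open>p i g\<close>.\<close>
    have "p i g \<le> 1 + e i - b" for g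
    proof -
      have "ereal b \<le> ereal (m i (- g))"
        unfolding b[symmetric] by (rule INF_lower) simp
      with m(2)[OF fin, of "- g"] show ?thesis
        by simp
    qed
    then have "sup_frequency S (N i) \<le> 1 + e i - b"
      unfolding a_def by (intro cSUP_least) auto
    with lower show ?case
      by (simp add: b)
  qed
  have "((\<lambda>i. INF g. ereal (m i g)) \<longlongrightarrow> ereal (1 - L)) (net_filter I le)"
  proof (rule tendsto_sandwich)
    show "\<forall>\<^sub>F i in net_filter I le.
        ereal (1 - sup_frequency S (N i) - e i) \<le> (INF g. ereal (m i g))"
      using inf_bounds by eventually_elim simp
    show "\<forall>\<^sub>F i in net_filter I le.
        (INF g. ereal (m i g)) \<le> ereal (1 - sup_frequency S (N i) + e i)"
      using inf_bounds by eventually_elim simp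
    show "((\<lambda>i. ereal (1 - sup_frequency S (N i) - e i)) \<longlongrightarrow> ereal (1 - L)) (net_filter I le)"
      using tendsto_diff[OF tendsto_diff[OF tendsto_const L] e, of 1] by (simp add: tendsto_ereal)
    show "((\<lambda>i. ereal (1 - sup_frequency S (N i) + e i)) \<longlongrightarrow> ereal (1 - L)) (net_filter I le)"
      using tendsto_add[OF tendsto_diff[OF tendsto_const L] e, of 1] by (simp add: tendsto_ereal)
  qed
  \<comment> \<open>\<open>Lim\<close> is a definite description; convergence along a proper filter
    determines its value.\<close>
  then have mdim: "lower_Banach_mdim scale I le N (range \<tau>) = ereal (1 - L)"
    unfolding lower_Banach_mdim_def m_def by (rule tendsto_Lim[OF folner_netD(3)[OF N]])
  have "upper_Banach_density I le N S =
      Liminf (net_filter I le) (\<lambda>i. ereal (sup_frequency S (N i)))"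
    unfolding upper_Banach_density_def
  proof (rule Liminf_eq)
    show "\<forall>\<^sub>F i in net_filter I le.
        (SUP g. ereal (real (card (S \<inter> (\<lambda>f. g + f) ` N i)) / real (card (N i)))) =
        ereal (sup_frequency S (N i))"
      using folner_netD(1)[OF N] by eventually_elim (simp add: ereal_sup_frequency)
  qed
  also have "\<dots> = ereal L"
    using folner_netD(3)[OF N] L by (intro lim_imp_Liminf tendsto_ereal)
  finally show ?thesis
    using that pre mdim by blast
qed

end

theorem theorem3:
  fixes scale :: "'k::field \<Rightarrow> 'a::ab_group_add \<Rightarrow> 'a"
    and Basis :: "'a set"
    and I :: "'i set"
    and le :: "'i \<Rightarrow> 'i \<Rightarrow> bool"
    and N :: "'i \<Rightarrow> 'g::group_add set"
    and \<tau> :: "('g \<Rightarrow> 'a) \<Rightarrow> 'g \<Rightarrow> 'a"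
  assumes "infinite (UNIV :: 'g set)"
    and "countable (UNIV :: 'g set)"
    and "folner_net I le N"
    and "finite_dimensional_vector_space scale Basis"
    and "linear_nuca scale \<tau>"
  shows
    "(\<forall>S. pre_injective_on \<tau> (vanishing_on S) \<longrightarrow>
        (\<forall>F. folner_seq F \<longrightarrow>
          upper_mdim scale F (range \<tau>) \<ge>
            (1 - upper_density F S) * ereal (real (vector_space.dim scale (UNIV :: 'a set)))))
     \<and>
     (\<forall>d::real.
        vector_space.dim scale (UNIV :: 'a set) = 1 \<and>
        lower_Banach_mdim scale I le N (range \<tau>) > ereal (1 - d) \<longrightarrow>
          (\<exists>S. upper_Banach_density I le N S \<le> ereal d \<and>
               pre_injective_on \<tau> (vanishing_on S)))"
proof -
  interpret V: finite_dimensional_vector_space scale Basis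
    by (rule assms(4))
  obtain K where "linear_local_map scale Basis \<tau> K"
    using V.linear_local_map_if_linear_nuca[OF assms(5)] by blast
  then interpret linear_local_map scale Basis \<tau> K .
  have "\<exists>S. upper_Banach_density I le N S \<le> ereal d \<and> pre_injective_on \<tau> (vanishing_on S)"
    if dim: "card Basis = 1" and d: "lower_Banach_mdim scale I le N (range \<tau>) > ereal (1 - d)" for d
  proof -
    obtain S L where S: "pre_injective_on \<tau> (vanishing_on S)"
        "upper_Banach_density I le N S = ereal L"
        "lower_Banach_mdim scale I le N (range \<tau>) = ereal (1 - L)"
      using exists_pre_injective_lower_Banach_mdim[OF assms(3) dim] by blast
    with d show ?thesis
      by (intro exI[of _ S]) simp
  qed
  \<comment> \<open>The dimension of the value space is \<open>card Basis\<close>, the form in which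
    both parts are available.\<close>
  then show ?thesis
    using upper_mdim_image_ge by simp
qed

end
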